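(* Let $B$ be a Banach space, let $(A_n)_{n\in\mathbb{Z}}\in l_\infty(\mathbb{Z},\mathcal{L}(B))$ with every $A_n$ invertible. Suppose that the homogeneous equation $x_{n+1}=A_nx_n$ is exponentially dichotomous on the semi-axes $\mathbb{Z}_+$ and $\mathbb{Z}_-$ with projectors $P$ and $Q$ respectively, and that the operator $D=P-(I-Q):B\to B$ is generalized invertible. Suppose in addition that $$[P,Q]=PQ-QP=0,\qquad PQ=Q$$ (the case of exponential trichotomy on $\mathbb{Z}$). Then for every $h=(h_n)_{n\in\mathbb{Z}}\in l_\infty(\mathbb{Z},B)$ the equation $x_{n+1}=A_nx_n+h_n$, $n\in\mathbb{Z}$, has at least one solution bounded on $\mathbb{Z}$.
   Context: $\mathcal{L}(B)$ denotes the bounded linear operators on $B$; $l_\infty(\mathbb{Z},Y)$ denotes the bounded sequences indexed by $\mathbb{Z}$ with values in $Y$, with the sup norm. $\mathbb{Z}_+=\{n\in\mathbb{Z}:n\ge 0\}$, $\mathbb{Z}_-=\{n\in\mathbb{Z}:n\le 0\}$. Evolution operator: $U(0)=I$, $U(n)=A_{n-1}A_{n-2}\cdots A_0$ for $n>0$, and $U(n)=A_n^{-1}A_{n+1}^{-1}\cdots A_{-1}^{-1}$ for $n<0$, so that $U(n+1)=A_nU(n)$ for all $n\in\mathbb{Z}$; $U^{-1}(n)$ is the inverse of $U(n)$. Exponential dichotomy on $\mathbb{Z}_+$ and $\mathbb{Z}_-$ with projectors $P$ and $Q$: $P,Q\in\mathcal{L}(B)$ satisfy $P^2=P$, $Q^2=Q$,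 and there are constants $k_1,k_2\ge 1$ and $0<\lambda_1,\lambda_2<1$ such that for all $m,n\in\mathbb{Z}_+$ $$\|U(n)PU^{-1}(m)\|\le k_1\lambda_1^{n-m}\ (n\ge m),\qquad \|U(n)(I-P)U^{-1}(m)\|\le k_1\lambda_1^{m-n}\ (m\ge n),$$ and for all $m,n\in\mathbb{Z}_-$ $$\|U(n)QU^{-1}(m)\|\le k_2\lambda_2^{n-m}\ (n\ge m),\qquad \|U(n)(I-Q)U^{-1}(m)\|\le k_2\lambda_2^{m-n}\ (m\ge n).$$ An operator $D\in\mathcal{L}(B)$ is generalized invertible if there is $D^-\in\mathcal{L}(B)$ with $D^-DD^-=D^-$ and $DD^-D=D$. *)

theory Defs
  imports "HOL-Analysis.Analysis"
begin

text \<open>Invertibility in the algebra of bounded operators: the inverse is required to be bounded.\<close>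

definition blinfun_invertible :: "('a::real_normed_vector \<Rightarrow>\<^sub>L 'a) \<Rightarrow> bool" where
  "blinfun_invertible T \<longleftrightarrow> (\<exists>S. S o\<^sub>L T = id_blinfun \<and> T o\<^sub>L S = id_blinfun)"

text \<open>Meaningful only for invertible operators.\<close>

definition blinfun_inverse :: "('a::real_normed_vector \<Rightarrow>\<^sub>L 'a) \<Rightarrow> ('a \<Rightarrow>\<^sub>L 'a)" where
  "blinfun_inverse T = (THE S. S o\<^sub>L T = id_blinfun \<and> T o\<^sub>L S = id_blinfun)"

primrec evol_forward ::
  "(int \<Rightarrow> ('a::real_normed_vector \<Rightarrow>\<^sub>L 'a)) \<Rightarrow> nat \<Rightarrow> ('a \<Rightarrow>\<^sub>L 'a)" where
  "evol_forward A 0 = id_blinfun"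
| "evol_forward A (Suc k) = A (int k) o\<^sub>L evol_forward A k"

text \<open>\<open>evol_backward A k\<close> is \<open>U(-k)\<close>, the product of the inverses of
  \<open>A (-k), A (-k+1), \<dots>, A (-1)\<close> in this order.\<close>

primrec evol_backward ::
  "(int \<Rightarrow> ('a::real_normed_vector \<Rightarrow>\<^sub>L 'a)) \<Rightarrow> nat \<Rightarrow> ('a \<Rightarrow>\<^sub>L 'a)" where
  "evol_backward A 0 = id_blinfun"
| "evol_backward A (Suc k) = blinfun_inverse (A (- int (Suc k))) o\<^sub>L evol_backward A k"

definition evol :: "(int \<Rightarrow> ('a::real_normed_vector \<Rightarrow>\<^sub>L 'a)) \<Rightarrow> int \<Rightarrow> ('a \<Rightarrow>\<^sub>L 'a)" where
  "evol A n = (if n \<ge> 0 then evol_forward A (nat n) else evol_backward A (nat (- n)))"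

text \<open>Exponential dichotomy of \<open>x (n+1) = A n (x n)\<close> on a set \<open>J\<close> of integers with projector \<open>P\<close>;
  it is used for \<open>J = {0..}\<close> and \<open>J = {..0}\<close>.\<close>

definition exp_dichotomy_on ::
  "int set \<Rightarrow> (int \<Rightarrow> ('a::real_normed_vector \<Rightarrow>\<^sub>L 'a)) \<Rightarrow> ('a \<Rightarrow>\<^sub>L 'a) \<Rightarrow> bool" where
  "exp_dichotomy_on J A P \<longleftrightarrow>
     P o\<^sub>L P = P \<and>
     (\<exists>k r :: real. k \<ge> 1 \<and> 0 < r \<and> r < 1 \<and>
       (\<forall>m\<in>J. \<forall>n\<in>J. n \<ge> m \<longrightarrow>
          norm (evol A n o\<^sub>L P o\<^sub>L blinfun_inverse (evol A m)) \<le> k * r powi (n - m)) \<and>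
       (\<forall>m\<in>J. \<forall>n\<in>J. m \<ge> n \<longrightarrow>
          norm (evol A n o\<^sub>L (id_blinfun - P) o\<^sub>L blinfun_inverse (evol A m)) \<le> k * r powi (m - n)))"

definition generalized_invertible :: "('a::real_normed_vector \<Rightarrow>\<^sub>L 'a) \<Rightarrow> bool" where
  "generalized_invertible D \<longleftrightarrow> (\<exists>G. G o\<^sub>L D o\<^sub>L G = G \<and> D o\<^sub>L G o\<^sub>L D = D)"

end

theory Submission
  imports Defs
begin

text \<open>
  Write \<open>U = evol A\<close>. A dichotomy with projector \<open>P\<close> on a set \<open>J\<close> of integers yields the Green
  kernel \<open>G n k = U n P U\<^sup>-\<^sup>1 k\<close> for \<open>k \<le> n\<close> and \<open>G n k = - U n (I - P) U\<^sup>-\<^sup>1 k\<close> for \<open>k > n\<close>, whose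
  norm decays like \<open>r ^ \<bar>n - k\<bar>\<close>. Hence \<open>x n = (\<Sum>k\<in>J. G n k (h (k - 1)))\<close> is a bounded solution
  of the inhomogeneous equation along \<open>J\<close>: \<open>A n\<close> maps each summand to its successor, except for
  \<open>k = n + 1\<close>, where the jump \<open>P + (I - P) = I\<close> of the kernel produces \<open>h n\<close>
  (\<open>exp_dichotomy_on_bounded_solution\<close>).

  Applied to both half-axes, this gives solutions \<open>x\<close> on \<open>n \<ge> 0\<close> and \<open>y\<close> on \<open>n \<le> 0\<close>. They remain
  bounded solutions when \<open>U n (P \<xi>)\<close> is added to \<open>x\<close> and \<open>U n ((I - Q) \<eta>)\<close> to \<open>y\<close>
  (\<open>exp_dichotomy_on_stable_bounded\<close>, \<open>exp_dichotomy_on_unstable_bounded\<close>), so they can be glued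
  at \<open>0\<close> as soon as \<open>x 0 + P \<xi> = y 0 + (I - Q) \<eta>\<close>. With \<open>z = x 0 - y 0\<close> the choice
  \<open>\<xi> = - Q z\<close>, \<open>\<eta> = z\<close> solves this equation: \<open>(I - Q) \<eta> - P \<xi> = z - Q z + P (Q z)\<close>, which is \<open>z\<close>
  because \<open>P Q = Q\<close>. In other words, \<open>z = Q z + (I - Q) z\<close> already splits \<open>z\<close> along the ranges
  of \<open>P\<close> and \<open>I - Q\<close>.
\<close>

section \<open>The evolution operator\<close>

lemma blinfun_inverse_eqI:
  assumes "S o\<^sub>L T = id_blinfun" "T o\<^sub>L S = id_blinfun"
  shows "blinfun_inverse T = S"
  unfolding blinfun_inverse_def
proof (rule the_equality)
  fix R assume R: "R o\<^sub>L T = id_blinfun \<and> T o\<^sub>L R = id_blinfun"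
  have "R x = S x" for x
  proof -
    have "R x = R (T (S x))"
      using assms(2) by (metis blinfun_apply_blinfun_compose blinfun_apply_id_blinfun)
    also have "\<dots> = S x"
      using R by (metis blinfun_apply_blinfun_compose blinfun_apply_id_blinfun)
    finally show ?thesis .
  qed
  then show "R = S" by (rule blinfun_eqI)
qed (use assms in auto)

lemma blinfun_inverse_works:
  assumes "blinfun_invertible T"
  shows "blinfun_inverse T o\<^sub>L T = id_blinfun" "T o\<^sub>L blinfun_inverse T = id_blinfun"
  using assms blinfun_inverse_eqI unfolding blinfun_invertible_def by metis+

lemma blinfun_inverse_apply:
  assumes "blinfun_invertible T"
  shows "blinfun_inverse T (T x) = x" "T (blinfun_inverse T x) = x"
  using blinfun_inverse_works[OF assms]
  by (metis blinfun_apply_blinfun_compose blinfun_apply_id_blinfun)+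

lemma blinfun_inverse_id: "blinfun_inverse id_blinfun = id_blinfun"
  by (rule blinfun_inverse_eqI) (auto intro: blinfun_eqI)

lemma blinfun_invertible_id: "blinfun_invertible id_blinfun"
  unfolding blinfun_invertible_def by (rule exI[of _ id_blinfun]) (auto intro: blinfun_eqI)

lemma blinfun_invertible_inverse:
  "blinfun_invertible T \<Longrightarrow> blinfun_invertible (blinfun_inverse T)"
  using blinfun_inverse_works unfolding blinfun_invertible_def by blast

lemma blinfun_invertible_compose:
  assumes "blinfun_invertible S" "blinfun_invertible T"
  shows "blinfun_invertible (S o\<^sub>L T)"
  unfolding blinfun_invertible_def
  by (rule exI[of _ "blinfun_inverse T o\<^sub>L blinfun_inverse S"])
    (auto intro!: blinfun_eqI simp: blinfun_inverse_apply assms)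

lemma evol_0: "evol A 0 = id_blinfun"
  by (simp add: evol_def)

lemma blinfun_invertible_evol:
  assumes "\<And>n. blinfun_invertible (A n)"
  shows "blinfun_invertible (evol A n)"
proof -
  have "blinfun_invertible (evol_forward A k)" for k
    by (induction k) (auto intro: blinfun_invertible_id blinfun_invertible_compose assms)
  moreover have "blinfun_invertible (evol_backward A k)" for k
    by (induction k) (auto intro: blinfun_invertible_id blinfun_invertible_compose
        blinfun_invertible_inverse assms)
  ultimately show ?thesis by (simp add: evol_def)
qed

lemma evol_step:
  assumes "\<And>n. blinfun_invertible (A n)"
  shows "evol A (n + 1) x = A n (evol A n x)"
proof (cases "n \<ge> 0")
  case True
  then have "nat (n + 1) = Suc (nat n)" by simp
  then show ?thesis using True by (simp add: evol_def)
next
  case False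
  define k where "k = nat (- (n + 1))"
  have n: "n = - int (Suc k)" using False by (simp add: k_def)
  have *: "evol A (n + 1) = evol_backward A k"
    by (cases "k = 0") (auto simp: evol_def n)
  have "evol A n = blinfun_inverse (A n) o\<^sub>L evol_backward A k"
    unfolding evol_def n by (simp add: nat_add_distrib)
  then show ?thesis by (simp add: * blinfun_inverse_apply assms)
qed

section \<open>Two-sided geometric sums\<close>

lemma summable_on_power_abs_int:
  fixes r :: real
  assumes "0 < r" "r < 1"
  shows "(\<lambda>j::int. r ^ nat \<bar>j\<bar>) summable_on UNIV"
proof -
  have s: "(\<lambda>i::nat. r ^ i) summable_on UNIV"
    using assms by (intro norm_summable_imp_summable_on) (simp add: summable_geometric)
  have "(\<lambda>j::int. r ^ nat \<bar>j\<bar>) summable_on (range int)"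
    using s by (subst summable_on_reindex) (auto simp: o_def)
  moreover have "(\<lambda>j::int. r ^ nat \<bar>j\<bar>) summable_on (range (\<lambda>i. - int i))"
    using s by (subst summable_on_reindex) (auto simp: o_def inj_def)
  ultimately have "(\<lambda>j::int. r ^ nat \<bar>j\<bar>) summable_on (range int \<union> range (\<lambda>i. - int i))"
    by (rule summable_on_union)
  moreover have "range int \<union> range (\<lambda>i. - int i) = UNIV"
    by (auto simp: image_iff) (metis int_cases2)
  ultimately show ?thesis by simp
qed

lemma has_sum_power_dist_int:
  fixes r :: real
  assumes "0 < r" "r < 1"
  shows "((\<lambda>k::int. r ^ nat \<bar>n - k\<bar>) has_sum (\<Sum>\<^sub>\<infinity>j::int. r ^ nat \<bar>j\<bar>)) UNIV"
proof -
  have "bij_betw (\<lambda>k::int. n - k) UNIV UNIV"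
    by (rule bij_betwI[where g = "\<lambda>k. n - k"]) auto
  from has_sum_reindex_bij_betw[OF this, of "\<lambda>j. r ^ nat \<bar>j\<bar>"] show ?thesis
    using has_sum_infsum[OF summable_on_power_abs_int[OF assms]] by simp
qed

section \<open>Bounded solutions along a dichotomy\<close>

lemma exp_dichotomy_onE:
  assumes "exp_dichotomy_on J A P"
  obtains K r :: real where "K \<ge> 1" "0 < r" "r < 1"
    "\<And>m n. m \<in> J \<Longrightarrow> n \<in> J \<Longrightarrow> m \<le> n \<Longrightarrow>
       norm (evol A n o\<^sub>L P o\<^sub>L blinfun_inverse (evol A m)) \<le> K * r ^ nat \<bar>n - m\<bar>"
    "\<And>m n. m \<in> J \<Longrightarrow> n \<in> J \<Longrightarrow> n \<le> m \<Longrightarrow>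
       norm (evol A n o\<^sub>L (id_blinfun - P) o\<^sub>L blinfun_inverse (evol A m)) \<le> K * r ^ nat \<bar>n - m\<bar>"
proof -
  have powi: "r powi j = r ^ nat \<bar>j\<bar>" if "j \<ge> 0" for r :: real and j :: int
    using that by (simp add: power_int_def)
  from assms obtain K r :: real where *: "K \<ge> 1" "0 < r" "r < 1"
    and P: "\<And>m n. m \<in> J \<Longrightarrow> n \<in> J \<Longrightarrow> m \<le> n \<Longrightarrow>
       norm (evol A n o\<^sub>L P o\<^sub>L blinfun_inverse (evol A m)) \<le> K * r powi (n - m)"
    and Q: "\<And>m n. m \<in> J \<Longrightarrow> n \<in> J \<Longrightarrow> n \<le> m \<Longrightarrow>
       norm (evol A n o\<^sub>L (id_blinfun - P) o\<^sub>L blinfun_inverse (evol A m)) \<le> K * r powi (m - n)"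
    unfolding exp_dichotomy_on_def by blast
  show ?thesis
  proof (rule that[OF *])
    fix m n assume mn: "m \<in> J" "n \<in> J"
    show "norm (evol A n o\<^sub>L P o\<^sub>L blinfun_inverse (evol A m)) \<le> K * r ^ nat \<bar>n - m\<bar>" if "m \<le> n"
      using P[OF mn that] powi[of "n - m" r] that by simp
    show "norm (evol A n o\<^sub>L (id_blinfun - P) o\<^sub>L blinfun_inverse (evol A m))
        \<le> K * r ^ nat \<bar>n - m\<bar>" if "n \<le> m"
      using Q[OF mn that] powi[of "m - n" r] that by (simp add: abs_minus_commute)
  qed
qed

text \<open>The term \<open>k = 0\<close> of the sum for \<open>J = {0..}\<close> involves \<open>h (-1)\<close>; it only contributes a bounded
  solution of the homogeneous equation, so the same formula serves every index set \<open>J\<close>.\<close>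

lemma exp_dichotomy_on_bounded_solution:
  fixes A :: "int \<Rightarrow> ('a::banach \<Rightarrow>\<^sub>L 'a)" and h :: "int \<Rightarrow> 'a"
  assumes inv: "\<And>n. blinfun_invertible (A n)"
    and dich: "exp_dichotomy_on J A P"
    and h: "bounded (range h)"
  obtains x where "bounded (x ` J)"
    "\<And>n. n \<in> J \<Longrightarrow> n + 1 \<in> J \<Longrightarrow> x (n + 1) = A n (x n) + h n"
proof -
  let ?U = "evol A" and ?V = "\<lambda>k. blinfun_inverse (evol A k)"
  obtain K r :: real where K: "K \<ge> 1" and r: "0 < r" "r < 1"
    and P: "\<And>m n. m \<in> J \<Longrightarrow> n \<in> J \<Longrightarrow> m \<le> n \<Longrightarrow> norm (?U n o\<^sub>L P o\<^sub>L ?V m) \<le> K * r ^ nat \<bar>n - m\<bar>"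
    and I_P: "\<And>m n. m \<in> J \<Longrightarrow> n \<in> J \<Longrightarrow> n \<le> m \<Longrightarrow>
       norm (?U n o\<^sub>L (id_blinfun - P) o\<^sub>L ?V m) \<le> K * r ^ nat \<bar>n - m\<bar>"
    by (rule exp_dichotomy_onE[OF dich]) (rule that; blast)
  obtain H where H: "\<And>n. norm (h n) \<le> H"
    using h by (auto simp: bounded_iff)
  define S where "S = (\<Sum>\<^sub>\<infinity>j::int. r ^ nat \<bar>j\<bar>)"
  \<comment> \<open>The Green kernel of the dichotomy.\<close>
  define G where "G n k = (if k \<le> n then ?U n o\<^sub>L P o\<^sub>L ?V k
    else - (?U n o\<^sub>L (id_blinfun - P) o\<^sub>L ?V k))" for n k
  define f where "f n k = (if k \<in> J then G n k (h (k - 1)) else 0)" for n k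
  have H0: "H \<ge> 0" using H[of 0] norm_ge_zero order_trans by blast
  have f_le: "norm (f n k) \<le> K * H * r ^ nat \<bar>n - k\<bar>" if "n \<in> J" for n k
  proof (cases "k \<in> J")
    case True
    have "norm (G n k) \<le> K * r ^ nat \<bar>n - k\<bar>"
      using P[OF True that] I_P[OF True that] by (simp add: G_def)
    then have "norm (G n k (h (k - 1))) \<le> (K * r ^ nat \<bar>n - k\<bar>) * H"
      by (rule order_trans[OF norm_blinfun mult_mono]) (use H K r in auto)
    then show ?thesis using True by (simp add: f_def mult_ac)
  next
    case False
    then show ?thesis using K H0 r by (simp add: f_def)
  qed
  \<comment> \<open>The majorant has the same sum for every \<open>n\<close>, which makes the bound on \<open>x n\<close> uniform.\<close>
  have dom: "((\<lambda>k. K * H * r ^ nat \<bar>n - k\<bar>) has_sum K * H * S) UNIV" for n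
    unfolding S_def by (intro has_sum_cmult_right has_sum_power_dist_int r)
  have f_abs: "(\<lambda>k. norm (f n k)) summable_on UNIV" if "n \<in> J" for n
    by (rule Infinite_Sum.abs_summable_on_comparison_test'[OF has_sum_imp_summable[OF dom]])
      (use f_le[OF that] in auto)
  have f_sum: "f n summable_on UNIV" if "n \<in> J" for n
    using f_abs[OF that] by (rule abs_summable_summable)
  define x where "x n = (\<Sum>\<^sub>\<infinity>k. f n k)" for n
  have "norm (x n) \<le> K * H * S" if "n \<in> J" for n
  proof -
    have "norm (x n) \<le> (\<Sum>\<^sub>\<infinity>k. norm (f n k))"
      unfolding x_def by (rule norm_infsum_bound[OF f_abs[OF that]])
    also have "\<dots> \<le> K * H * S"
      by (rule has_sum_mono[OF has_sum_infsum[OF f_abs[OF that]] dom]) (rule f_le[OF that])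
    finally show ?thesis .
  qed
  then have "bounded (x ` J)" by (intro boundedI) auto
  moreover have "x (n + 1) = A n (x n) + h n" if n: "n \<in> J" "n + 1 \<in> J" for n
  proof -
    have step: "f (n + 1) k = A n (f n k) + (if k = n + 1 then h n else 0)" for k
    proof (cases "k = n + 1")
      case True
      have "A n (?U n (?V (n + 1) y)) = y" for y
        unfolding evol_step[where A = A, OF inv, symmetric]
        by (rule blinfun_inverse_apply[OF blinfun_invertible_evol[where A = A, OF inv]])
      then show ?thesis using True n
        by (simp add: f_def G_def evol_step[where A = A, OF inv] blinfun.minus_left
            blinfun.minus_right blinfun.diff_left blinfun.diff_right)
    next
      case False
      then have "k \<le> n + 1 \<longleftrightarrow> k \<le> n" by linarith
      then show ?thesis using False
        by (auto simp: f_def G_def evol_step[where A = A, OF inv] blinfun.minus_left blinfun.minus_right)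
    qed
    have "((\<lambda>k. A n (f n k)) has_sum A n (x n)) UNIV"
      unfolding x_def
      by (rule has_sum_bounded_linear[OF blinfun.bounded_linear_right
            has_sum_infsum[OF f_sum[OF n(1)]]])
    moreover have "((\<lambda>k. if k = n + 1 then h n else 0) has_sum h n) UNIV"
      by (rule has_sum_finite_neutralI[of "{n + 1}"]) auto
    ultimately have "(f (n + 1) has_sum (A n (x n) + h n)) UNIV"
      unfolding step by (rule has_sum_add)
    then show ?thesis unfolding x_def[of "n + 1"] by (rule infsumI)
  qed
  ultimately show ?thesis by (rule that)
qed

lemma exp_dichotomy_on_stable_bounded:
  assumes "exp_dichotomy_on {0..} A P"
  shows "bounded ((\<lambda>n. evol A n (P v)) ` {0..})"
proof -
  obtain K r :: real where K: "K \<ge> 1" and r: "0 < r" "r < 1"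
    and P: "\<And>m n. m \<in> {0..} \<Longrightarrow> n \<in> {0..} \<Longrightarrow> m \<le> n \<Longrightarrow>
      norm (evol A n o\<^sub>L P o\<^sub>L blinfun_inverse (evol A m)) \<le> K * r ^ nat \<bar>n - m\<bar>"
    by (rule exp_dichotomy_onE[OF assms]) (rule that; blast)
  have "norm (evol A n (P v)) \<le> K * norm v" if "n \<ge> 0" for n
  proof -
    let ?T = "evol A n o\<^sub>L P o\<^sub>L blinfun_inverse (evol A 0)"
    have "norm ?T \<le> K * r ^ nat \<bar>n - 0\<bar>" using P[of 0 n] that by simp
    also have "\<dots> \<le> K" using K r by (simp add: power_le_one mult_left_le)
    finally have "norm (?T v) \<le> K * norm v"
      by (rule order_trans[OF norm_blinfun mult_right_mono]) simp
    then show ?thesis by (simp add: evol_0 blinfun_inverse_id)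
  qed
  then show ?thesis by (auto simp: bounded_iff)
qed

lemma exp_dichotomy_on_unstable_bounded:
  assumes "exp_dichotomy_on {..0} A Q"
  shows "bounded ((\<lambda>n. evol A n ((id_blinfun - Q) v)) ` {..0})"
proof -
  obtain K r :: real where K: "K \<ge> 1" and r: "0 < r" "r < 1"
    and Q: "\<And>m n. m \<in> {..0} \<Longrightarrow> n \<in> {..0} \<Longrightarrow> n \<le> m \<Longrightarrow>
      norm (evol A n o\<^sub>L (id_blinfun - Q) o\<^sub>L blinfun_inverse (evol A m)) \<le> K * r ^ nat \<bar>n - m\<bar>"
    by (rule exp_dichotomy_onE[OF assms]) (rule that; blast)
  have "norm (evol A n ((id_blinfun - Q) v)) \<le> K * norm v" if "n \<le> 0" for n
  proof -
    let ?T = "evol A n o\<^sub>L (id_blinfun - Q) o\<^sub>L blinfun_inverse (evol A 0)"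
    have "norm ?T \<le> K * r ^ nat \<bar>n - 0\<bar>" using Q[of 0 n] that by simp
    also have "\<dots> \<le> K" using K r by (simp add: power_le_one mult_left_le)
    finally have "norm (?T v) \<le> K * norm v"
      by (rule order_trans[OF norm_blinfun mult_right_mono]) simp
    then show ?thesis by (simp add: evol_0 blinfun_inverse_id)
  qed
  then show ?thesis by (auto simp: bounded_iff)
qed

section \<open>Gluing the two half-axes\<close>

theorem mainTheorem2:
  fixes A :: "int \<Rightarrow> ('a::banach \<Rightarrow>\<^sub>L 'a)"
    and P Q :: "'a \<Rightarrow>\<^sub>L 'a"
  assumes "bounded (range A)"
    and "\<And>n. blinfun_invertible (A n)"
    and "exp_dichotomy_on {0..} A P"
    and "exp_dichotomy_on {..0} A Q"
    and "generalized_invertible (P - (id_blinfun - Q))"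
    and "P o\<^sub>L Q - Q o\<^sub>L P = 0"
    and "P o\<^sub>L Q = Q"
  shows "\<forall>h :: int \<Rightarrow> 'a. bounded (range h) \<longrightarrow>
           (\<exists>x :: int \<Rightarrow> 'a. bounded (range x) \<and> (\<forall>n. x (n + 1) = blinfun_apply (A n) (x n) + h n))"
proof (intro allI impI)
  fix h :: "int \<Rightarrow> 'a"
  assume h: "bounded (range h)"
  obtain x where x: "bounded (x ` {0..})"
    and x_step: "\<And>n. n \<ge> 0 \<Longrightarrow> x (n + 1) = A n (x n) + h n"
    by (rule exp_dichotomy_on_bounded_solution[where A = A, OF assms(2,3) h]) auto
  obtain y where y: "bounded (y ` {..0})"
    and y_step: "\<And>n. n < 0 \<Longrightarrow> y (n + 1) = A n (y n) + h n"
    by (rule exp_dichotomy_on_bounded_solution[where A = A, OF assms(2,4) h]) auto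
  define z where "z = x 0 - y 0"
  define x' where "x' n = x n + evol A n (P (- Q z))" for n
  define y' where "y' n = y n + evol A n ((id_blinfun - Q) z)" for n
  have x': "bounded (x' ` {0..})"
    unfolding x'_def by (rule bounded_plus_comp[OF x exp_dichotomy_on_stable_bounded[OF assms(3)]])
  have y': "bounded (y' ` {..0})"
    unfolding y'_def
    by (rule bounded_plus_comp[OF y exp_dichotomy_on_unstable_bounded[OF assms(4)]])
  have x'_step: "x' (n + 1) = A n (x' n) + h n" if "n \<ge> 0" for n
    using x_step[OF that]
    by (simp add: x'_def evol_step[where A = A, OF assms(2)] blinfun.add_right)
  have y'_step: "y' (n + 1) = A n (y' n) + h n" if "n < 0" for n
    using y_step[OF that]
    by (simp add: y'_def evol_step[where A = A, OF assms(2)] blinfun.add_right)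
  have "P (Q v) = Q v" for v
    using assms(7) by (metis blinfun_apply_blinfun_compose)
  then have match: "x' 0 = y' 0"
    by (simp add: x'_def y'_def evol_0 z_def blinfun.diff_left blinfun.diff_right
        blinfun.minus_right)
  \<comment> \<open>By \<open>match\<close>, \<open>w\<close> also equals \<open>y'\<close> at \<open>0\<close>, which is needed for the step from \<open>-1\<close> to \<open>0\<close>.\<close>
  define w where "w n = (if n \<ge> 0 then x' n else y' n)" for n
  have w_neg: "w n = y' n" if "n \<le> 0" for n
    using that match by (cases "n = 0") (auto simp: w_def)
  have "range w \<subseteq> x' ` {0..} \<union> y' ` {..0}"
    by (auto simp: w_def)
  then have "bounded (range w)"
    using x' y' bounded_subset bounded_Un by metis
  moreover have "w (n + 1) = A n (w n) + h n" for n
  proof (cases "n \<ge> 0")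
    case True
    then show ?thesis using x'_step by (simp add: w_def)
  next
    case False
    then show ?thesis using y'_step w_neg[of n] w_neg[of "n + 1"] by simp
  qed
  ultimately show "\<exists>x. bounded (range x) \<and> (\<forall>n. x (n + 1) = A n (x n) + h n)"
    by blast
qed

end
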